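(* There exists an absolute constant $c$ such that the following holds. Let $\mathfrak{L}$ be a collection of $L$ (finitely many) lines in $\mathbb{R}^3$, and let $J$ be the set of joints formed by $\mathfrak{L}$. Then $$\sum_{x \in J} N(x)^{1/2} \leq c \cdot L^{3/2},$$ where $N(x)$ denotes the multiplicity of the joint $x$. (The constant $c$ is independent of $\mathfrak{L}$.)
   Context: A point $x\in\mathbb{R}^3$ is a joint for a collection $\mathfrak{L}$ of lines in $\mathbb{R}^3$ if there are at least three lines of $\mathfrak{L}$ passing through $x$ whose directions span $\mathbb{R}^3$. The multiplicity $N(x)$ of a joint $x$ is the number of unordered triples of lines of $\mathfrak{L}$ through $x$ whose directions span $\mathbb{R}^3$. *)

theory Defs
  imports "HOL-Analysis.Analysis"
begin

definition is_line :: "(real^3) set \<Rightarrow> bool" where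
  "is_line l \<longleftrightarrow> affine l \<and> aff_dim l = 1"

text \<open>All direction vectors of a line, with the zero vector; for a line
  this is the one-dimensional linear subspace parallel to it.\<close>

definition line_directions :: "(real^3) set \<Rightarrow> (real^3) set" where
  "line_directions l = {q - p | p q. p \<in> l \<and> q \<in> l}"

definition directions_span :: "(real^3) set set \<Rightarrow> bool" where
  "directions_span T \<longleftrightarrow> span (\<Union>l\<in>T. line_directions l) = UNIV"

text \<open>Since \<open>card\<close> vanishes on infinite sets, only finite \<open>T\<close> are considered;
  this loses nothing, as some three lines of a spanning family already span.\<close>

definition joints :: "(real^3) set set \<Rightarrow> (real^3) set" where
  "joints \<LL> = {x. \<exists>T. T \<subseteq> \<LL> \<and> card T \<ge> 3 \<and> (\<forall>l\<in>T. x \<in> l) \<and> directions_span T}"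

definition joint_multiplicity :: "(real^3) set set \<Rightarrow> real^3 \<Rightarrow> nat" where
  "joint_multiplicity \<LL> x =
     card {T. T \<subseteq> \<LL> \<and> card T = 3 \<and> (\<forall>l\<in>T. x \<in> l) \<and> directions_span T}"

lemma lines_eq_if_two_common_points:
  assumes "is_line l" "is_line m" "x \<in> l \<inter> m" "y \<in> l \<inter> m" "x \<noteq> y"
  shows "l = m"
proof -
  have "affine hull {x, y} = k" if "is_line k" "x \<in> k" "y \<in> k" for k
  proof (rule affine_dim_equal)
    show "affine hull {x, y} \<subseteq> k"
      using that by (intro hull_minimal) (auto simp: is_line_def)
    show "aff_dim (affine hull {x, y}) = aff_dim k"
      using that assms(5) by (simp add: is_line_def aff_dim_2)
  qed (use that in \<open>auto simp: is_line_def\<close>)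
  from this[of l] this[of m] show ?thesis using assms by auto
qed

text \<open>Sums over \<open>joints \<LL>\<close> are therefore genuine finite sums.\<close>

lemma finite_joints:
  assumes "finite \<LL>" "\<And>l. l \<in> \<LL> \<Longrightarrow> is_line l"
  shows "finite (joints \<LL>)"
proof (rule finite_subset)
  let ?P = "{(l, m) \<in> \<LL> \<times> \<LL>. l \<noteq> m}"
  show "joints \<LL> \<subseteq> (\<Union>(l, m)\<in>?P. l \<inter> m)"
  proof
    fix x assume "x \<in> joints \<LL>"
    then obtain T where T: "T \<subseteq> \<LL>" "card T \<ge> 3" "\<forall>l\<in>T. x \<in> l"
      by (auto simp: joints_def)
    have "\<not> card T \<le> Suc 0" "finite T" using T(2) by (auto intro: card_ge_0_finite)
    then obtain l m where "l \<in> T" "m \<in> T" "l \<noteq> m"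
      by (auto simp: card_le_Suc0_iff_eq)
    then show "x \<in> (\<Union>(l, m)\<in>?P. l \<inter> m)" using T by blast
  qed
  have "finite (l \<inter> m)" if "(l, m) \<in> ?P" for l m
  proof (cases "l \<inter> m = {}")
    case False
    then obtain x where "x \<in> l \<inter> m" by blast
    then have "l \<inter> m \<subseteq> {x}"
      using that assms(2) lines_eq_if_two_common_points[of l m x] by blast
    then show ?thesis by (rule finite_subset) simp
  qed simp
  moreover have "finite ?P"
    by (rule finite_subset[of _ "\<LL> \<times> \<LL>"]) (use assms(1) in auto)
  ultimately show "finite (\<Union>(l, m)\<in>?P. l \<inter> m)" by auto
qed

end

theory Submission
  imports Defs
begin

text \<open>
The proof is the polynomial method with a careful choice of vanishing conditions. Write \<open>W\<close> for the
sum of \<open>w x = N x ^ (1/2)\<close> over the joints and \<open>L\<close> for the number of lines.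

At a joint \<open>p\<close> on three lines with independent directions \<open>u1\<close>, \<open>u2\<close>, \<open>u3\<close>, one asks of a polynomial that
its derivatives \<open>u1^i u2^j u3^k\<close> vanish at \<open>p\<close> for all \<open>(i, j, k)\<close> in a box with side lengths
\<open>B1\<close>, \<open>B2\<close>, \<open>B3\<close>. The side belonging to a line \<open>l\<close> is its \<open>quota\<close> at \<open>p\<close>, which is chosen so that
a polynomial in one variable of degree at most \<open>n\<close> that vanishes on \<open>l\<close> to the order of the quota at every
joint is zero. All further derivatives at all joints then vanish automatically, one order after
the other, so the conditions leave only the zero polynomial. Hence there are at least
as many conditions as coefficients: with exponents at most \<open>m\<close> in each of the three variables, so that
\<open>n = 3 m\<close>, the sum of \<open>B1 B2 B3\<close> over the joints is at least \<open>(m + 1)^3\<close>. This is \<open>dimension_count\<close>.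

The quotas on a line add up to at most \<open>n\<close> plus one for each joint on the line, but they may be shared
out among the joints in many ways. A natural number \<open>h p\<close> for each joint, its handicap, says by how many
orders the vanishing at \<open>p\<close> is ahead. Raising \<open>h p\<close> can only raise the quotas at \<open>p\<close> and only lower those at
the other joints, and the dimension count holds for every \<open>h\<close> and for every nonempty subset of the joints.
By an extremal argument, \<open>exists_balanced_handicap\<close>, some \<open>h\<close> makes
\<open>(B1 + 1) (B2 + 1) (B3 + 1)\<close> larger than \<open>m^3 w p / W\<close> for every joint \<open>p\<close> and, at the same time, for
all \<open>N p\<close> triples of lines that form the joint.

Fix this \<open>h\<close> and let \<open>b p\<close> be the sum of \<open>B + 1\<close> over all lines through \<open>p\<close>. Expanding \<open>(b p)^3\<close> gives
every triple at least once, so \<open>(b p)^3\<close> is at least \<open>N p * m^3 w p / W = (m w p)^3 / W\<close>. Taking cube roots and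
summing over the joints yields \<open>m W / W^(1/3)\<close> on one side. On the other side, the sum of all
\<open>B + 1\<close> taken line by line is at most \<open>L (3 m + 2 |J|)\<close>, which is \<open>5 L m\<close> for \<open>m = |J|\<close>. So
\<open>W^(2/3)\<close> is at most \<open>5 L\<close>, that is, \<open>W\<close> is at most \<open>(5 L)^(3/2)\<close>.
\<close>

section \<open>Underdetermined linear systems\<close>

text \<open>
For the induction on the number of equations, solve all equations but \<open>e\<close> twice, each time with one
more unknown set to zero: the second solution \<open>y\<close> vanishes at some \<open>v\<close> at which the first one, \<open>x\<close>, does not.
The combination of \<open>x\<close> and \<open>y\<close> that also solves \<open>e\<close> is then nonzero at \<open>v\<close>, unless \<open>y\<close> solves \<open>e\<close> already.
\<close>

lemma underdetermined_system_has_nonzero_solution: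
  fixes F :: "'e \<Rightarrow> ('u \<Rightarrow> real) \<Rightarrow> real"
  assumes "finite E" "card E < card U"
    and lin: "\<And>e a b f g. F e (\<lambda>u. a * f u + b * g u) = a * F e f + b * F e g"
  shows "\<exists>x. (\<exists>u. x u \<noteq> 0) \<and> (\<forall>u. u \<notin> U \<longrightarrow> x u = 0) \<and> (\<forall>e\<in>E. F e x = 0)"
  using assms(1,2)
proof (induction E arbitrary: U rule: finite_induct)
  case empty
  then obtain u where "u \<in> U" by fastforce
  then show ?case by (intro exI[of _ "\<lambda>v. if v = u then 1 else 0"]) auto
next
  case (insert e E)
  have IH: "\<exists>x. (\<exists>u. x u \<noteq> 0) \<and> (\<forall>u. u \<notin> U \<longrightarrow> x u = 0) \<and> x v = 0 \<and> (\<forall>e\<in>E. F e x = 0)"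
    if "v \<in> U" for v
  proof -
    have "card E < card (U - {v})"
      using insert.prems insert.hyps that by (simp add: card_Diff_singleton)
    from insert.IH[OF this] show ?thesis by blast
  qed
  obtain u where "u \<in> U" using insert.prems by fastforce
  from IH[OF this] obtain x v
    where x: "x v \<noteq> 0" "\<forall>u. u \<notin> U \<longrightarrow> x u = 0" "\<forall>e\<in>E. F e x = 0" by blast
  then have "v \<in> U" by blast
  from IH[OF this] obtain y w
    where y: "y w \<noteq> 0" "\<forall>u. u \<notin> U \<longrightarrow> y u = 0" "y v = 0" "\<forall>e\<in>E. F e y = 0" by blast
  show ?case
  proof (cases "F e y = 0")
    case True
    with y show ?thesis by blast
  next
    case False
    define z where "z = (\<lambda>u. F e x * y u + (- F e y) * x u)"
    have "F e' z = F e x * F e' y + (- F e y) * F e' x" for e'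
      unfolding z_def by (rule lin)
    moreover have "z v \<noteq> 0" using False x(1) y(3) by (simp add: z_def)
    moreover have "z u = 0" if "u \<notin> U" for u using x(2) y(2) that by (simp add: z_def)
    ultimately show ?thesis using x(3) y(4) by (intro exI[of _ z] conjI) auto
  qed
qed

section \<open>Real polynomials with many zeros\<close>

lemma order_ge_if_derivatives_vanish:
  fixes f :: "real poly"
  assumes "f \<noteq> 0" "\<And>k. k < e \<Longrightarrow> poly ((pderiv ^^ k) f) s = 0"
  shows "e \<le> order s f"
  using assms
proof (induction e arbitrary: f)
  case (Suc e)
  have root: "poly f s = 0" using Suc.prems(2)[of 0] by simp
  have "pderiv f \<noteq> 0"
  proof
    assume "pderiv f = 0"
    then obtain a where "f = [:a:]" by (auto simp: pderiv_eq_0_iff elim: degree_eq_zeroE)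
    with root Suc.prems(1) show False by simp
  qed
  moreover have "poly ((pderiv ^^ k) (pderiv f)) s = 0" if "k < e" for k
    using Suc.prems(2)[of "Suc k"] that by (simp add: funpow_swap1)
  ultimately have "e \<le> order s (pderiv f)" by (rule Suc.IH)
  moreover have "order s f = Suc (order s (pderiv f))"
    using Suc.prems(1) root by (rule order_pderiv)
  ultimately show ?case by simp
qed simp

lemma sum_order_le_degree:
  fixes f :: "real poly"
  assumes "f \<noteq> 0" "finite S"
  shows "(\<Sum>s\<in>S. order s f) \<le> degree f"
proof -
  have "(\<Sum>s\<in>S. order s f) = (\<Sum>s\<in>S \<inter> set_mset (proots f). count (proots f) s)"
    using assms by (intro sum.mono_neutral_cong_right) (auto simp: order_root)
  also have "\<dots> \<le> size (proots f)"
    unfolding size_multiset_overloaded_eq by (intro sum_mono2) auto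
  also have "\<dots> \<le> degree f" by (rule size_proots_le)
  finally show ?thesis .
qed

lemma poly_eq_0_if_many_zeros:
  fixes f :: "real poly"
  assumes "finite S" "\<And>s k. s \<in> S \<Longrightarrow> k < e s \<Longrightarrow> poly ((pderiv ^^ k) f) s = 0"
    and "degree f < (\<Sum>s\<in>S. e s)"
  shows "f = 0"
proof (rule ccontr)
  assume "f \<noteq> 0"
  then have "(\<Sum>s\<in>S. e s) \<le> (\<Sum>s\<in>S. order s f)"
    using assms(2) by (intro sum_mono order_ge_if_derivatives_vanish)
  also have "\<dots> \<le> degree f" by (rule sum_order_le_degree[OF \<open>f \<noteq> 0\<close> assms(1)])
  finally show False using assms(3) by simp
qed

section \<open>Polynomials in several variables and their directional derivatives\<close>

text \<open>
A polynomial whose exponent in each variable is at most \<open>m\<close> is represented by its coefficient function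
on exponent vectors, which is zero outside of \<open>exponents m\<close> (see \<open>supported\<close> below). Derivatives become
explicit operations on coefficients, so that linearity and commutation are elementary.
Bounding each exponent instead of the total degree makes the number of coefficients a power and
costs only a constant factor.
\<close>

definition exponents :: "nat \<Rightarrow> ('n::finite \<Rightarrow> nat) set" where
  "exponents m = {\<mu>. \<forall>a. \<mu> a \<le> m}"

lemma exponents_eq_PiE: "exponents m = (UNIV :: 'n::finite set) \<rightarrow>\<^sub>E {..m}"
  by (auto simp: exponents_def PiE_def Pi_def)

lemma finite_exponents [simp]: "finite (exponents m)"
  by (simp add: exponents_eq_PiE finite_PiE)

lemma card_exponents: "card (exponents m :: ('n::finite \<Rightarrow> nat) set) = Suc m ^ CARD('n)"
  by (simp add: exponents_eq_PiE card_PiE)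

definition evaluate :: "nat \<Rightarrow> (('n::finite \<Rightarrow> nat) \<Rightarrow> real) \<Rightarrow> real^'n \<Rightarrow> real" where
  "evaluate m c x = (\<Sum>\<mu>\<in>exponents m. c \<mu> * (\<Prod>a\<in>UNIV. x $ a ^ \<mu> a))"

definition partial :: "'n::finite \<Rightarrow> (('n \<Rightarrow> nat) \<Rightarrow> real) \<Rightarrow> ('n \<Rightarrow> nat) \<Rightarrow> real" where
  "partial a c \<mu> = real (Suc (\<mu> a)) * c (\<mu>(a := Suc (\<mu> a)))"

definition directional :: "real^'n \<Rightarrow> (('n::finite \<Rightarrow> nat) \<Rightarrow> real) \<Rightarrow> ('n \<Rightarrow> nat) \<Rightarrow> real" where
  "directional v c \<mu> = (\<Sum>a\<in>UNIV. v $ a * partial a c \<mu>)"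

definition line_monomial :: "real^'n \<Rightarrow> real^'n \<Rightarrow> ('n::finite \<Rightarrow> nat) \<Rightarrow> real poly" where
  "line_monomial x v \<mu> = (\<Prod>a\<in>UNIV. [:x $ a, v $ a:] ^ \<mu> a)"

text \<open>
The restriction of a polynomial to the line through \<open>x\<close> in direction \<open>v\<close>, as a formal polynomial in the
parameter of the line; see \<open>poly_line_poly\<close>.
\<close>

definition line_poly ::
  "nat \<Rightarrow> (('n::finite \<Rightarrow> nat) \<Rightarrow> real) \<Rightarrow> real^'n \<Rightarrow> real^'n \<Rightarrow> real poly" where
  "line_poly m c x v = (\<Sum>\<mu>\<in>exponents m. smult (c \<mu>) (line_monomial x v \<mu>))"

definition supported :: "nat \<Rightarrow> (('n::finite \<Rightarrow> nat) \<Rightarrow> real) \<Rightarrow> bool" where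
  "supported m c \<longleftrightarrow> (\<forall>\<mu>. \<mu> \<notin> exponents m \<longrightarrow> c \<mu> = 0)"

lemma poly_line_poly: "poly (line_poly m c x v) s = evaluate m c (x + s *\<^sub>R v)"
  by (simp add: line_poly_def line_monomial_def evaluate_def poly_sum poly_prod)

lemma degree_line_poly:
  fixes x :: "real^'n::finite"
  shows "degree (line_poly m c x v) \<le> CARD('n) * m"
  unfolding line_poly_def
proof (rule degree_sum_le)
  fix \<mu> :: "'n \<Rightarrow> nat" assume "\<mu> \<in> exponents m"
  have "degree (line_monomial x v \<mu>) \<le> (\<Sum>a\<in>UNIV. degree ([:x $ a, v $ a:] ^ \<mu> a))"
    unfolding line_monomial_def by (rule order.trans[OF degree_prod_sum_le]) auto
  also have "\<dots> \<le> (\<Sum>a::'n\<in>UNIV. m)"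
  proof (rule sum_mono)
    fix a :: 'n
    have "degree ([:x $ a, v $ a:] ^ \<mu> a) \<le> degree [:x $ a, v $ a:] * \<mu> a"
      by (rule degree_power_le)
    also have "\<dots> \<le> 1 * \<mu> a" by (intro mult_right_mono) auto
    finally show "degree ([:x $ a, v $ a:] ^ \<mu> a) \<le> m"
      using \<open>\<mu> \<in> exponents m\<close> by (auto simp: exponents_def intro: order.trans)
  qed
  finally show "degree (smult (c \<mu>) (line_monomial x v \<mu>)) \<le> CARD('n) * m"
    using degree_smult_le order.trans by (fastforce)
qed simp

lemma pderiv_line_monomial:
  "pderiv (line_monomial x v \<mu>) =
     (\<Sum>a\<in>UNIV. smult (v $ a * real (\<mu> a)) (line_monomial x v (\<mu>(a := \<mu> a - 1))))"
  unfolding line_monomial_def pderiv_prod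
proof (rule sum.cong)
  fix a
  have "(\<Prod>b\<in>UNIV. [:x $ b, v $ b:] ^ (\<mu>(a := \<mu> a - 1)) b) =
      [:x $ a, v $ a:] ^ (\<mu> a - 1) * (\<Prod>b\<in>UNIV - {a}. [:x $ b, v $ b:] ^ \<mu> b)"
    by (subst prod.remove[of _ a]) (auto intro!: prod.cong)
  then show "(\<Prod>b\<in>UNIV - {a}. [:x $ b, v $ b:] ^ \<mu> b) * pderiv ([:x $ a, v $ a:] ^ \<mu> a) =
      smult (v $ a * real (\<mu> a)) (\<Prod>b\<in>UNIV. [:x $ b, v $ b:] ^ (\<mu>(a := \<mu> a - 1)) b)"
    by (simp add: pderiv_power pderiv_pCons mult_ac)
qed simp

text \<open>
Shifting the exponent of the variable \<open>a\<close> matches the terms on both sides. The support condition disposes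
of the terms with exponent \<open>m\<close> on the right, whose coefficients come from outside of \<open>exponents m\<close>.
\<close>

lemma sum_partial:
  assumes "supported m c"
  shows "(\<Sum>\<mu>\<in>exponents m. smult (real (\<mu> a) * c \<mu>) (line_monomial x v (\<mu>(a := \<mu> a - 1)))) =
    (\<Sum>\<mu>\<in>exponents m. smult (partial a c \<mu>) (line_monomial x v \<mu>))" (is "?l = ?r")
proof -
  have "?l = (\<Sum>\<mu>\<in>{\<mu>\<in>exponents m. 0 < \<mu> a}.
      smult (real (\<mu> a) * c \<mu>) (line_monomial x v (\<mu>(a := \<mu> a - 1))))"
    by (intro sum.mono_neutral_right) auto
  also have "\<dots> = (\<Sum>\<mu>\<in>{\<mu>\<in>exponents m. \<mu> a < m}. smult (partial a c \<mu>) (line_monomial x v \<mu>))"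
  proof (rule sum.reindex_bij_witness[of _ "\<lambda>\<mu>. \<mu>(a := Suc (\<mu> a))" "\<lambda>\<mu>. \<mu>(a := \<mu> a - 1)"])
    fix \<mu> assume "\<mu> \<in> {\<mu> \<in> exponents m. 0 < \<mu> a}"
    then have "0 < \<mu> a" and le: "\<mu> b \<le> m" for b by (auto simp: exponents_def)
    then have "\<mu> a - 1 < m" using le[of a] by linarith
    then show "\<mu>(a := \<mu> a - 1) \<in> {\<mu> \<in> exponents m. \<mu> a < m}"
      using le by (auto simp: exponents_def)
  qed (auto simp: exponents_def partial_def)
  also have "\<dots> = ?r"
  proof (intro sum.mono_neutral_left ballI)
    fix \<mu> assume "\<mu> \<in> exponents m - {\<mu> \<in> exponents m. \<mu> a < m}"
    then have "\<mu>(a := Suc (\<mu> a)) \<notin> exponents m" by (auto simp: exponents_def intro!: exI[of _ a])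
    then show "smult (partial a c \<mu>) (line_monomial x v \<mu>) = 0"
      using assms by (simp add: supported_def partial_def)
  qed auto
  finally show ?thesis .
qed

lemma pderiv_sum: "pderiv (sum f A) = (\<Sum>x\<in>A. pderiv (f x))"
  by (induction A rule: infinite_finite_induct) (auto simp: pderiv_add)

lemma smult_sum_right: "smult r (sum f A) = (\<Sum>x\<in>A. smult r (f x))"
  by (induction A rule: infinite_finite_induct) (auto simp: smult_add_right)

lemma pderiv_line_poly:
  assumes "supported m c"
  shows "pderiv (line_poly m c x v) = line_poly m (directional v c) x v"
proof -
  have "pderiv (line_poly m c x v) = (\<Sum>\<mu>\<in>exponents m. \<Sum>a\<in>UNIV. smult (v $ a)
      (smult (real (\<mu> a) * c \<mu>) (line_monomial x v (\<mu>(a := \<mu> a - 1)))))"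
    by (simp add: line_poly_def pderiv_sum pderiv_smult pderiv_line_monomial
        smult_sum_right mult_ac)
  also have "\<dots> = (\<Sum>a\<in>UNIV. smult (v $ a) (\<Sum>\<mu>\<in>exponents m.
      smult (real (\<mu> a) * c \<mu>) (line_monomial x v (\<mu>(a := \<mu> a - 1)))))"
    by (subst sum.swap) (simp add: smult_sum_right)
  also have "\<dots> = (\<Sum>a\<in>UNIV. smult (v $ a)
      (\<Sum>\<mu>\<in>exponents m. smult (partial a c \<mu>) (line_monomial x v \<mu>)))"
    by (simp only: sum_partial[OF assms])
  also have "\<dots> = line_poly m (directional v c) x v"
    unfolding line_poly_def directional_def smult_sum smult_sum_right
    by (subst sum.swap) simp
  finally show ?thesis .
qed

lemma partial_combination:
  "partial a (\<lambda>\<mu>. r * c \<mu> + s * d \<mu>) = (\<lambda>\<mu>. r * partial a c \<mu> + s * partial a d \<mu>)"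
  by (simp add: partial_def fun_eq_iff algebra_simps)

lemma partial_sum:
  "partial a (\<lambda>\<mu>. \<Sum>b\<in>A. r b * f b \<mu>) = (\<lambda>\<mu>. \<Sum>b\<in>A. r b * partial a (f b) \<mu>)"
  by (simp add: partial_def fun_eq_iff sum_distrib_left mult_ac)

lemma partial_commute: "partial a (partial b c) = partial b (partial a c)"
  by (cases "a = b") (auto simp: partial_def fun_eq_iff fun_upd_twist)

lemma directional_combination:
  "directional v (\<lambda>\<mu>. r * c \<mu> + s * d \<mu>) =
     (\<lambda>\<mu>. r * directional v c \<mu> + s * directional v d \<mu>)"
  by (simp add: directional_def partial_combination fun_eq_iff algebra_simps sum.distrib
      sum_distrib_left)

lemma directional_add_scale:
  "directional (r *\<^sub>R v + s *\<^sub>R w) c = (\<lambda>\<mu>. r * directional v c \<mu> + s * directional w c \<mu>)"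
  by (simp add: directional_def fun_eq_iff algebra_simps sum.distrib sum_distrib_left)

lemma directional_axis: "directional (axis a 1) c = partial a c"
  by (simp add: directional_def fun_eq_iff axis_def if_distrib[of "\<lambda>x. x * _"] cong: if_cong)

lemma directional_commute: "directional v (directional w c) = directional w (directional v c)"
proof
  fix \<mu>
  have *: "partial a (directional w c) = (\<lambda>\<mu>. \<Sum>b\<in>UNIV. w $ b * partial a (partial b c) \<mu>)" for a w
    unfolding directional_def by (rule partial_sum)
  have "directional v (directional w c) \<mu> =
      (\<Sum>a\<in>UNIV. \<Sum>b\<in>UNIV. v $ a * w $ b * partial a (partial b c) \<mu>)" for v w
    by (subst directional_def) (simp add: * sum_distrib_left mult_ac)
  then show "directional v (directional w c) \<mu> = directional w (directional v c) \<mu>"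
    by (subst (1 2) \<open>\<And>w v. directional v (directional w c) \<mu> = _ w v\<close>, subst sum.swap)
      (simp add: partial_commute mult_ac)
qed

lemma directional_funpow_commute:
  "directional v ((directional w ^^ i) c) = (directional w ^^ i) (directional v c)"
  by (induction i) (simp_all add: directional_commute[of v w])

lemma funpow_directional_commute:
  "(directional v ^^ i) ((directional w ^^ j) c) = (directional w ^^ j) ((directional v ^^ i) c)"
  by (induction i) (simp_all add: directional_funpow_commute)

lemma supported_directional:
  assumes "supported m c"
  shows "supported m (directional v c)"
  unfolding supported_def
proof (intro allI impI)
  fix \<mu> :: "'a \<Rightarrow> nat" assume "\<mu> \<notin> exponents m"
  then obtain b where "\<not> \<mu> b \<le> m" by (auto simp: exponents_def)
  then have "\<mu>(a := Suc (\<mu> a)) \<notin> exponents m" for a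
    by (auto simp: exponents_def intro!: exI[of _ b])
  then show "directional v c \<mu> = 0"
    using assms by (simp add: directional_def partial_def supported_def)
qed

lemma supported_funpow: "supported m c \<Longrightarrow> supported m ((directional v ^^ i) c)"
  by (induction i) (simp_all add: supported_directional)

lemma pderiv_funpow_line_poly:
  assumes "supported m c"
  shows "(pderiv ^^ k) (line_poly m c x v) = line_poly m ((directional v ^^ k) c) x v"
  by (induction k) (simp_all add: pderiv_line_poly supported_funpow assms)

lemma evaluate_combination:
  "evaluate m (\<lambda>\<mu>. r * c \<mu> + s * d \<mu>) x = r * evaluate m c x + s * evaluate m d x"
  by (simp add: evaluate_def algebra_simps sum.distrib sum_distrib_left)

lemma funpow_directional_combination:
  "(directional v ^^ i) (\<lambda>\<mu>. r * c \<mu> + s * d \<mu>) =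
     (\<lambda>\<mu>. r * (directional v ^^ i) c \<mu> + s * (directional v ^^ i) d \<mu>)"
  by (induction i) (simp_all add: directional_combination)

lemma fold_directional_combination:
  "fold directional vs (\<lambda>\<mu>. r * c \<mu> + s * d \<mu>) =
     (\<lambda>\<mu>. r * fold directional vs c \<mu> + s * fold directional vs d \<mu>)"
  by (induction vs arbitrary: c d) (simp_all add: directional_combination)

text \<open>
All iterated directional derivatives of order below \<open>R\<close> are required to vanish, whatever their
directions, because lines with different directions meet at \<open>x\<close> and the condition has to serve all of them.
\<close>

definition vanishes_to_order ::
  "nat \<Rightarrow> (('n::finite \<Rightarrow> nat) \<Rightarrow> real) \<Rightarrow> real^'n \<Rightarrow> nat \<Rightarrow> bool" where
  "vanishes_to_order m c x R \<longleftrightarrow>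
     (\<forall>vs. length vs < R \<longrightarrow> evaluate m (fold directional vs c) x = 0)"

lemma vanishes_to_order_directional:
  "vanishes_to_order m c x R \<Longrightarrow> vanishes_to_order m (directional v c) x (R - 1)"
  unfolding vanishes_to_order_def
proof (intro allI impI)
  fix vs :: "(real^'a) list" assume "\<forall>vs. length vs < R \<longrightarrow> evaluate m (fold directional vs c) x = 0"
    and "length vs < R - 1"
  then have "evaluate m (fold directional (v # vs) c) x = 0" by (metis Suc_lessI Suc_less_eq
      length_Cons less_diff_conv add.commute plus_1_eq_Suc)
  then show "evaluate m (fold directional vs (directional v c)) x = 0" by simp
qed

lemma vanishes_to_order_funpow:
  "vanishes_to_order m c x R \<Longrightarrow> vanishes_to_order m ((directional v ^^ i) c) x (R - i)"
  by (induction i) (auto dest: vanishes_to_order_directional)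

lemma evaluate_if_vanishes: "vanishes_to_order m c x R \<Longrightarrow> 0 < R \<Longrightarrow> evaluate m c x = 0"
  unfolding vanishes_to_order_def by (metis fold_Nil id_apply list.size(3))

text \<open>
By induction on a bound for the total degree: the partial derivatives inherit the hypotheses
with a smaller bound, so they are zero, and a polynomial with zero partial derivatives is constant.
\<close>

lemma coefficients_eq_0_if_vanishes_to_all_orders:
  fixes x :: "real^'n::finite"
  assumes "supported m c" "\<And>R. vanishes_to_order m c x R"
  shows "c = (\<lambda>_. 0)"
proof -
  have "c = (\<lambda>_. 0)" if "\<And>\<mu>. N < (\<Sum>a\<in>UNIV. \<mu> a) \<Longrightarrow> c \<mu> = 0"
    and "supported m c" "\<And>R. vanishes_to_order m c x R" for N and c :: "('n \<Rightarrow> nat) \<Rightarrow> real"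
    using that
  proof (induction N arbitrary: c)
    case 0
    have nonconst: "c \<mu> = 0" if "\<mu> \<noteq> (\<lambda>_. 0)" for \<mu>
      using that by (intro 0(1)) (auto simp: fun_eq_iff intro: sum_pos2)
    have "0 = evaluate m c x" using evaluate_if_vanishes[OF 0(3)[of 1]] by simp
    also have "\<dots> = (\<Sum>\<mu>\<in>{\<lambda>_. 0}. c \<mu> * (\<Prod>a\<in>UNIV. x $ a ^ \<mu> a))"
      unfolding evaluate_def
      by (intro sum.mono_neutral_right) (auto simp: nonconst, simp add: exponents_def)
    finally have "c (\<lambda>_. 0) = 0" by simp
    then show ?case using nonconst by (metis ext)
  next
    case (Suc N)
    have partial_0: "partial a c = (\<lambda>_. 0)" for a
    proof (rule Suc.IH)
      fix \<mu> :: "'n \<Rightarrow> nat" assume "N < (\<Sum>a\<in>UNIV. \<mu> a)"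
      moreover have "(\<Sum>b\<in>UNIV. (\<mu>(a := Suc (\<mu> a))) b) = Suc (\<Sum>b\<in>UNIV. \<mu> b)"
        by (subst (1 2) sum.remove[of UNIV a]) (auto intro: sum.cong)
      ultimately show "partial a c \<mu> = 0"
        by (simp add: partial_def Suc.prems(1) del: fun_upd_apply)
    next
      show "supported m (partial a c)"
        using supported_directional[OF Suc.prems(2)] by (metis directional_axis)
      show "vanishes_to_order m (partial a c) x R" for R
        using vanishes_to_order_directional[OF Suc.prems(3)[of "Suc R"], of "axis a 1"]
        by (simp add: directional_axis)
    qed
    show ?case
    proof (rule Suc.IH)
      fix \<mu> :: "'n \<Rightarrow> nat" assume "N < (\<Sum>a\<in>UNIV. \<mu> a)"
      then obtain a where "0 < \<mu> a" by (metis gr0I less_nat_zero_code sum.neutral)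
      then have "(\<mu>(a := \<mu> a - 1))(a := Suc ((\<mu>(a := \<mu> a - 1)) a)) = \<mu>" by auto
      with fun_cong[OF partial_0[of a], of "\<mu>(a := \<mu> a - 1)"] show "c \<mu> = 0"
        by (simp add: partial_def)
    qed (use Suc.prems in auto)
  qed
  moreover have "c \<mu> = 0" if "CARD('n) * m < (\<Sum>a\<in>UNIV. \<mu> a)" for \<mu>
  proof -
    have "\<mu> \<notin> exponents m"
      using that sum_bounded_above[of UNIV \<mu> m] by (auto simp: exponents_def)
    then show ?thesis using assms(1) by (simp add: supported_def)
  qed
  ultimately show ?thesis using assms by blast
qed

text \<open>
Derivatives in arbitrary directions are multilinear in the directions and commute, so they are combinations of
the sorted derivatives along the spanning vectors.
\<close>

lemma evaluate_derivatives_0_if_basis_derivatives_0: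
  fixes u1 u2 u3 :: "real^'n::finite"
  assumes span: "span {u1, u2, u3} = UNIV"
    and "\<And>i j k. i + j + k = r \<Longrightarrow> evaluate m
      ((directional u1 ^^ i) ((directional u2 ^^ j) ((directional u3 ^^ k) c))) x = 0"
    and "length vs = r"
  shows "evaluate m (fold directional vs c) x = 0"
  using assms(2,3)
proof (induction r arbitrary: vs c)
  case 0
  then show ?case using "0.prems"(1)[of 0 0 0] by simp
next
  case (Suc r)
  then obtain v ws where vs: "vs = v # ws" "length ws = r" by (auto simp: length_Suc_conv)
  have "evaluate m (fold directional ws (directional u1 c)) x = 0"
    using Suc.prems(1)[of "Suc _"] vs(2)
    by (intro Suc.IH) (auto simp: directional_funpow_commute[symmetric])
  moreover have "evaluate m (fold directional ws (directional u2 c)) x = 0"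
    using Suc.prems(1)[of _ "Suc _"] vs(2)
    by (intro Suc.IH) (auto simp: directional_funpow_commute[symmetric])
  moreover have "evaluate m (fold directional ws (directional u3 c)) x = 0"
    using Suc.prems(1)[of _ _ "Suc _"] vs(2)
    by (intro Suc.IH) (auto simp: directional_funpow_commute[symmetric])
  moreover obtain a b d where "v = a *\<^sub>R u1 + 1 *\<^sub>R (b *\<^sub>R u2 + d *\<^sub>R u3)"
    using span unfolding span_insert by (force simp: algebra_simps)
  moreover have "directional v c = (\<lambda>\<mu>. a * directional u1 c \<mu> +
      1 * (b * directional u2 c \<mu> + d * directional u3 c \<mu>))"
    by (simp only: \<open>v = _\<close> directional_add_scale)
  ultimately show ?case
    unfolding vs fold_Cons o_apply by (simp only: fold_directional_combination evaluate_combination)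
      simp
qed

section \<open>Handicaps and quotas\<close>

text \<open>
Vanishing conditions are imposed at all points of \<open>J\<close> in parallel, with a head start: when the order
\<open>i\<close> is reached at \<open>p\<close>, the order \<open>i + h q - h p\<close> is reached at \<open>q\<close> (and none if this is negative, which
is why truncated subtraction is right). The quota of the line \<open>l\<close> at \<open>p\<close> is the first order at \<open>p\<close> for which the
orders at the points on \<open>l\<close> add up to more than \<open>n\<close>, so that a polynomial of degree at most \<open>n\<close> on \<open>l\<close>
with these zeros is zero.
\<close>

definition quota :: "nat \<Rightarrow> 'a set \<Rightarrow> ('a \<Rightarrow> nat) \<Rightarrow> 'a \<Rightarrow> 'a set \<Rightarrow> nat" where
  "quota n J h p l = (LEAST i. n < (\<Sum>q\<in>J \<inter> l. i + h q - h p))"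

lemma quota_le: "n < (\<Sum>q\<in>J \<inter> l. i + h q - h p) \<Longrightarrow> quota n J h p l \<le> i"
  unfolding quota_def by (rule Least_le)

lemma sum_at_Suc_degree:
  assumes "finite J" "p \<in> J \<inter> l"
  shows "n < (\<Sum>q\<in>J \<inter> l. Suc n + h q - h p)"
proof -
  have "Suc n + h p - h p \<le> (\<Sum>q\<in>J \<inter> l. Suc n + h q - h p)"
    using assms by (intro member_le_sum) auto
  then show ?thesis by simp
qed

lemma sum_at_quota:
  assumes "finite J" "p \<in> J \<inter> l" "quota n J h p l \<le> i"
  shows "n < (\<Sum>q\<in>J \<inter> l. i + h q - h p)"
proof -
  have "n < (\<Sum>q\<in>J \<inter> l. quota n J h p l + h q - h p)"
    unfolding quota_def by (rule LeastI, rule sum_at_Suc_degree[OF assms(1,2)])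
  also have "\<dots> \<le> (\<Sum>q\<in>J \<inter> l. i + h q - h p)"
    using assms(3) by (intro sum_mono) auto
  finally show ?thesis .
qed

lemma quota_le_Suc_degree: "finite J \<Longrightarrow> p \<in> J \<inter> l \<Longrightarrow> quota n J h p l \<le> Suc n"
  by (intro quota_le sum_at_Suc_degree)

text \<open>
Just before the quota of some \<open>p\<close> is reached, the orders at the points of \<open>l\<close> add up to at most \<open>n\<close>, and at each
point at most one order is missing to its own quota.
\<close>

lemma sum_quota_le:
  assumes "finite J"
  shows "(\<Sum>p\<in>J \<inter> l. quota n J h p l) \<le> n + card (J \<inter> l)"
proof (cases "\<exists>p\<in>J \<inter> l. 0 < quota n J h p l")
  case False
  then have "(\<Sum>p\<in>J \<inter> l. quota n J h p l) = 0" by simp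
  then show ?thesis by linarith
next
  case True
  then obtain p where p: "p \<in> J \<inter> l" "0 < quota n J h p l" by blast
  define i where "i = quota n J h p l - 1"
  have i: "i < quota n J h p l" "quota n J h p l = Suc i" using p(2) by (auto simp: i_def)
  have "quota n J h q l \<le> i + h q - h p + 1" if q: "q \<in> J \<inter> l" for q
  proof -
    have "n < (\<Sum>r\<in>J \<inter> l. Suc i + h r - h p)"
      using sum_at_quota[OF assms p(1), of n h "Suc i"] i by simp
    also have "\<dots> \<le> (\<Sum>r\<in>J \<inter> l. (Suc i + h q - h p) + h r - h q)"
      by (intro sum_mono) auto
    finally have "quota n J h q l \<le> Suc i + h q - h p" by (rule quota_le)
    then show ?thesis by linarith
  qed
  then have "(\<Sum>q\<in>J \<inter> l. quota n J h q l) \<le> (\<Sum>q\<in>J \<inter> l. i + h q - h p + 1)"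
    by (intro sum_mono)
  also have "\<dots> = (\<Sum>q\<in>J \<inter> l. i + h q - h p) + card (J \<inter> l)"
    by (subst sum.distrib) simp
  also have "(\<Sum>q\<in>J \<inter> l. i + h q - h p) \<le> n"
    using i(1) unfolding quota_def by (meson not_less_Least not_less)
  finally show ?thesis by simp
qed

lemma quota_raise_other:
  assumes "finite J" "p \<in> J \<inter> l" "p \<noteq> x"
  shows "quota n J (h(x := Suc (h x))) p l \<le> quota n J h p l"
proof (rule quota_le)
  have "n < (\<Sum>q\<in>J \<inter> l. quota n J h p l + h q - h p)"
    using assms by (intro sum_at_quota) auto
  also have "\<dots> \<le> (\<Sum>q\<in>J \<inter> l. quota n J h p l + (h(x := Suc (h x))) q - (h(x := Suc (h x))) p)"
    using assms(3) by (intro sum_mono) auto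
  finally show "n < \<dots>" .
qed

lemma quota_raise_self:
  assumes "finite J" "x \<in> J \<inter> l"
  shows "quota n J (h(x := Suc (h x))) x l \<le> Suc (quota n J h x l)"
proof (rule quota_le)
  have "n < (\<Sum>q\<in>J \<inter> l. quota n J h x l + h q - h x)"
    using assms by (intro sum_at_quota) auto
  also have "\<dots> \<le> (\<Sum>q\<in>J \<inter> l. Suc (quota n J h x l) + (h(x := Suc (h x))) q - (h(x := Suc (h x))) x)"
    by (intro sum_mono) auto
  finally show "n < \<dots>" .
qed

text \<open>
The points outside of \<open>S\<close> are so far behind that they contribute nothing on \<open>l\<close> before the points in \<open>S\<close>
have used up the whole degree. So they can be forgotten.
\<close>

lemma quota_restrict_le:
  assumes "finite J" "S \<subseteq> J" "p \<in> S \<inter> l"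
    and far: "\<And>q. q \<in> J - S \<Longrightarrow> h q + Suc n \<le> h p"
  shows "quota n S h p l \<le> quota n J h p l"
proof (rule quota_le)
  have p: "p \<in> J \<inter> l" using assms by auto
  have "n < (\<Sum>q\<in>J \<inter> l. quota n J h p l + h q - h p)"
    using assms p by (intro sum_at_quota) auto
  also have "\<dots> = (\<Sum>q\<in>S \<inter> l. quota n J h p l + h q - h p)"
  proof (intro sum.mono_neutral_right ballI)
    fix q assume "q \<in> J \<inter> l - S \<inter> l"
    then have "h q + Suc n \<le> h p" using far by auto
    then show "quota n J h p l + h q - h p = 0"
      using quota_le_Suc_degree[OF assms(1) p, of n h] by simp
  qed (use assms in auto)
  finally show "n < (\<Sum>q\<in>S \<inter> l. quota n J h p l + h q - h p)" .
qed

text \<open>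
The intervals \<open>{k * d <.. k * d + d}\<close> for \<open>k < card J\<close> lie below \<open>h p\<close>, and there are more of them than
points other than \<open>p\<close>. Hence one of them contains no value of \<open>h\<close>.
\<close>

lemma exists_gap:
  fixes h :: "'a \<Rightarrow> nat"
  assumes "finite J" "p \<in> J" "card J * d < h p" "0 < d"
  obtains k where "k * d + d < h p" "\<And>q. q \<in> J \<Longrightarrow> h q \<le> k * d \<or> k * d + d < h q"
proof -
  \<comment> \<open>\<open>f q\<close> is the index of the interval that contains \<open>h q\<close>; subtracting 1 makes the intervals closed on the right.\<close>
  define f where "f q = (h q - 1) div d" for q
  have f: "f q = k" if "k * d < h q" "h q \<le> k * d + d" for q k
    unfolding f_def using that by (intro div_nat_eqI) (auto simp: mult.commute)
  have "\<exists>k<card J. k \<notin> f ` (J - {p})"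
  proof (rule ccontr)
    assume "\<not> ?thesis"
    then have "{..<card J} \<subseteq> f ` (J - {p})" by blast
    then have "card {..<card J} \<le> card (J - {p})"
      using assms(1) by (meson card_image_le card_mono finite_Diff finite_imageI le_trans)
    moreover have "card (J - {p}) < card J" using assms(1,2) by (rule card_Diff1_less)
    ultimately show False by simp
  qed
  then obtain k where k: "k < card J" "k \<notin> f ` (J - {p})" by blast
  have "Suc k * d \<le> card J * d" using k(1) by (intro mult_right_mono) auto
  with assms(3) have *: "k * d + d < h p" by simp
  have "h q \<le> k * d \<or> k * d + d < h q" if "q \<in> J" for q
  proof (rule ccontr)
    assume "\<not> ?thesis"
    then have "k * d < h q" "h q \<le> k * d + d" by auto
    then have "f q = k" "q \<noteq> p" using f * by auto
    with k(2) that show False by blast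
  qed
  with * show thesis by (rule that)
qed

text \<open>
Call \<open>h\<close> unspoilt if every point with a positive handicap still has a triple with product at
most \<open>\<theta>\<close>. An unspoilt \<open>h\<close> cannot have large values: by \<open>exists_gap\<close>, its large values would be separated
from the others by a gap, the set \<open>S\<close> of points above the gap would not notice the points below it, and the
counting hypothesis for \<open>S\<close> would contradict the smallness of \<open>\<theta>\<close>. So there is an unspoilt \<open>h\<close> with
the largest sum. Raising it at a point \<open>x\<close> spoils it, and only \<open>x\<close> itself can be responsible, since
the quotas at the other points do not grow. As the quotas at \<open>x\<close> grow by at most one, all products
at \<open>x\<close> exceed \<open>\<theta> x\<close> once each factor is increased by one.
\<close>

lemma exists_balanced_handicap:
  fixes J :: "'a set" and \<T> :: "'a \<Rightarrow> 'a set set set" and \<theta> :: "'a \<Rightarrow> real"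
  assumes fin: "finite J"
    and through: "\<And>p T l. p \<in> J \<Longrightarrow> T \<in> \<T> p \<Longrightarrow> l \<in> T \<Longrightarrow> p \<in> l"
    and count: "\<And>S h \<tau>. S \<subseteq> J \<Longrightarrow> S \<noteq> {} \<Longrightarrow> (\<And>p. p \<in> S \<Longrightarrow> \<tau> p \<in> \<T> p) \<Longrightarrow>
      K \<le> (\<Sum>p\<in>S. \<Prod>l\<in>\<tau> p. real (quota n S h p l))"
    and nonneg: "\<And>p. p \<in> J \<Longrightarrow> 0 \<le> \<theta> p" and small: "(\<Sum>p\<in>J. \<theta> p) < K"
  shows "\<exists>h. \<forall>p\<in>J. \<forall>T\<in>\<T> p. \<theta> p < (\<Prod>l\<in>T. real (Suc (quota n J h p l)))"
proof -
  define unspoilt where "unspoilt h \<longleftrightarrow>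
    (\<forall>p. p \<notin> J \<longrightarrow> h p = 0) \<and>
    (\<forall>p\<in>J. h p = 0 \<or> (\<exists>T\<in>\<T> p. (\<Prod>l\<in>T. real (quota n J h p l)) \<le> \<theta> p))" for h
  have bounded: "h p \<le> card J * Suc n" if h: "unspoilt h" and "p \<in> J" for h p
  proof (rule ccontr)
    assume "\<not> ?thesis"
    then have "card J * Suc n < h p" by simp
    then obtain k where k: "k * Suc n + Suc n < h p"
      "\<And>q. q \<in> J \<Longrightarrow> h q \<le> k * Suc n \<or> k * Suc n + Suc n < h q"
      using exists_gap[of J p "Suc n" h] fin \<open>p \<in> J\<close> by blast
    define S where "S = {q \<in> J. k * Suc n + Suc n < h q}"
    have "S \<subseteq> J" "S \<noteq> {}" using k(1) \<open>p \<in> J\<close> by (auto simp: S_def)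
    have far: "h r + Suc n \<le> h q" if "q \<in> S" "r \<in> J - S" for q r
      using that k(2)[of r] by (auto simp: S_def)
    have "\<exists>T\<in>\<T> q. (\<Prod>l\<in>T. real (quota n J h q l)) \<le> \<theta> q" if "q \<in> S" for q
    proof -
      have "h q \<noteq> 0" "q \<in> J" using that by (auto simp: S_def)
      with h show ?thesis unfolding unspoilt_def by metis
    qed
    then obtain \<tau> where \<tau>: "\<And>q. q \<in> S \<Longrightarrow> \<tau> q \<in> \<T> q"
      "\<And>q. q \<in> S \<Longrightarrow> (\<Prod>l\<in>\<tau> q. real (quota n J h q l)) \<le> \<theta> q" by metis
    have "K \<le> (\<Sum>q\<in>S. \<Prod>l\<in>\<tau> q. real (quota n S h q l))"
      using \<open>S \<subseteq> J\<close> \<open>S \<noteq> {}\<close> \<tau>(1) by (rule count)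
    also have "\<dots> \<le> (\<Sum>q\<in>S. \<Prod>l\<in>\<tau> q. real (quota n J h q l))"
    proof (intro sum_mono prod_mono conjI)
      fix q l assume "q \<in> S" "l \<in> \<tau> q"
      then have "q \<in> l" using through \<tau>(1) \<open>S \<subseteq> J\<close> by blast
      then show "real (quota n S h q l) \<le> real (quota n J h q l)"
        using quota_restrict_le[OF fin \<open>S \<subseteq> J\<close>, of q l h n] far \<open>q \<in> S\<close> by simp
    qed simp
    also have "\<dots> \<le> (\<Sum>q\<in>S. \<theta> q)" by (intro sum_mono \<tau>(2))
    also have "\<dots> \<le> (\<Sum>q\<in>J. \<theta> q)"
      using fin \<open>S \<subseteq> J\<close> nonneg by (intro sum_mono2) auto
    finally show False using small by simp
  qed
  have "unspoilt (\<lambda>_. 0)" by (simp add: unspoilt_def)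
  moreover have "\<forall>h. unspoilt h \<longrightarrow> (\<Sum>p\<in>J. h p) < Suc (\<Sum>p\<in>J. card J * Suc n)"
    by (intro allI impI le_imp_less_Suc sum_mono bounded)
  ultimately have "\<exists>h. unspoilt h \<and> (\<forall>g. unspoilt g \<longrightarrow> (\<Sum>p\<in>J. g p) \<le> (\<Sum>p\<in>J. h p))"
    by (rule Lattices_Big.ex_has_greatest_nat)
  then obtain h where h: "unspoilt h"
    and max: "\<And>g. unspoilt g \<Longrightarrow> (\<Sum>p\<in>J. g p) \<le> (\<Sum>p\<in>J. h p)" by blast
  show ?thesis
  proof (intro exI[of _ h] ballI)
    fix x T assume x: "x \<in> J" and T: "T \<in> \<T> x"
    define g where "g = h(x := Suc (h x))"
    have "(\<Sum>p\<in>J. h p) < (\<Sum>p\<in>J. g p)"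
      using fin x by (intro sum_strict_mono_ex1) (auto simp: g_def)
    then have "\<not> unspoilt g" using max[of g] by linarith
    moreover have "\<forall>p. p \<notin> J \<longrightarrow> g p = 0" using h x by (auto simp: unspoilt_def g_def)
    ultimately obtain p where p: "p \<in> J" "g p \<noteq> 0"
      "\<And>T. T \<in> \<T> p \<Longrightarrow> \<theta> p < (\<Prod>l\<in>T. real (quota n J g p l))"
      unfolding unspoilt_def by (meson not_less)
    have "p = x"
    proof (rule ccontr)
      assume "p \<noteq> x"
      then have "h p \<noteq> 0" using p(2) by (simp add: g_def)
      then obtain T where T: "T \<in> \<T> p" "(\<Prod>l\<in>T. real (quota n J h p l)) \<le> \<theta> p"
        using h p(1) unfolding unspoilt_def by metis
      have "(\<Prod>l\<in>T. real (quota n J g p l)) \<le> (\<Prod>l\<in>T. real (quota n J h p l))"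
        unfolding g_def using fin through[OF p(1) T(1)] p(1) \<open>p \<noteq> x\<close>
        by (intro prod_mono) (auto intro: quota_raise_other)
      with T p(3)[OF T(1)] show False by simp
    qed
    then have "\<theta> x < (\<Prod>l\<in>T. real (quota n J g x l))" using p(3) T by blast
    also have "\<dots> \<le> (\<Prod>l\<in>T. real (Suc (quota n J h x l)))"
    proof (intro prod_mono conjI)
      fix l assume "l \<in> T"
      then have "quota n J g x l \<le> Suc (quota n J h x l)"
        unfolding g_def using fin through[OF x T] x by (intro quota_raise_self) auto
      then show "real (quota n J g x l) \<le> real (Suc (quota n J h x l))" by simp
    qed simp
    finally show "\<theta> x < (\<Prod>l\<in>T. real (Suc (quota n J h x l)))" .
  qed
qed

section \<open>Vanishing at joints and the dimension count\<close>

text \<open>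
The points of \<open>l\<close> are described by membership: as a rewrite rule, the equation of \<open>l\<close> with a set that depends
on a point of \<open>l\<close> and on a direction chosen for \<open>l\<close> would not terminate.
\<close>

definition has_direction :: "(real^'n) set \<Rightarrow> real^'n \<Rightarrow> bool" where
  "has_direction l u \<longleftrightarrow> u \<noteq> 0 \<and> (\<forall>p\<in>l. \<forall>q. q \<in> l \<longleftrightarrow> (\<exists>s. q = p + s *\<^sub>R u))"

lemma is_line_has_direction:
  assumes "is_line l"
  shows "\<exists>u. has_direction l u"
proof -
  have "l \<noteq> {}" using assms by (auto simp: is_line_def)
  then obtain a where a: "a \<in> l" by blast
  have "l \<noteq> {a}" using assms by (auto simp: is_line_def)
  with a obtain b where b: "b \<in> l" "a \<noteq> b" by blast
  have on_line: "q \<in> l \<longleftrightarrow> (\<exists>s. q = p + s *\<^sub>R (b - a))" if "p \<in> l" for p q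
  proof -
    have "p + 1 *\<^sub>R (b - a) \<in> l"
      using assms a b that by (intro mem_affine_3_minus) (auto simp: is_line_def)
    moreover have "is_line (affine hull {p, p + (b - a)})"
      using b by (simp add: is_line_def aff_dim_2)
    ultimately have "l = affine hull {p, p + (b - a)}"
      using assms b that
      by (intro lines_eq_if_two_common_points[of l _ p "p + (b - a)"]) (auto intro: hull_inc)
    then have "q \<in> l \<longleftrightarrow> q \<in> affine hull {p, p + (b - a)}" by simp
    then show ?thesis by (simp add: affine_hull_2_alt image_iff)
  qed
  have "has_direction l (b - a)"
    unfolding has_direction_def using b(2) by (intro conjI ballI allI on_line) simp
  then show ?thesis by blast
qed

text \<open>
The restriction of \<open>g\<close> to \<open>l\<close> has degree at most \<open>CARD('n) * m\<close>, and since \<open>i\<close> has reached the quota,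
the prescribed zeros have a larger total multiplicity. So \<open>g\<close> vanishes on \<open>l\<close>, with all its derivatives along \<open>l\<close>.
\<close>

lemma derivative_along_line_vanishes:
  fixes u :: "real^'n::finite"
  assumes g: "supported m g" and fin: "finite J" and p: "p \<in> J \<inter> l"
    and dir: "has_direction l u"
    and vanishes: "\<And>q. q \<in> J \<inter> l \<Longrightarrow> vanishes_to_order m g q (i + h q - h p)"
    and quota: "quota (CARD('n) * m) J h p l \<le> i"
  shows "evaluate m ((directional u ^^ i) g) p = 0"
proof -
  have "u \<noteq> 0" and l: "q \<in> l \<longleftrightarrow> (\<exists>s. q = p + s *\<^sub>R u)" for q
    using dir p by (auto simp: has_direction_def)
  define \<phi> where "\<phi> = line_poly m g p u"
  have deriv: "poly ((pderiv ^^ k) \<phi>) s = evaluate m ((directional u ^^ k) g) (p + s *\<^sub>R u)" for k s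
    by (simp add: \<phi>_def pderiv_funpow_line_poly g poly_line_poly)
  define S where "S = {s. p + s *\<^sub>R u \<in> J}"
  have inj: "inj_on (\<lambda>s. p + s *\<^sub>R u) S" using \<open>u \<noteq> 0\<close> by (auto simp: inj_on_def)
  have image: "(\<lambda>s. p + s *\<^sub>R u) ` S = J \<inter> l"
    by (auto simp: S_def l)
  have "\<phi> = 0"
  proof (rule poly_eq_0_if_many_zeros)
    show "finite S" using inj image fin by (metis finite_Int finite_image_iff)
    show "poly ((pderiv ^^ k) \<phi>) s = 0" if "s \<in> S" "k < i + h (p + s *\<^sub>R u) - h p" for s k
    proof -
      have "vanishes_to_order m ((directional u ^^ k) g) (p + s *\<^sub>R u)
          (i + h (p + s *\<^sub>R u) - h p - k)"
        using that(1) image by (intro vanishes_to_order_funpow vanishes) auto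
      then show ?thesis unfolding deriv by (rule evaluate_if_vanishes) (use that(2) in simp)
    qed
    have "degree \<phi> \<le> CARD('n) * m" unfolding \<phi>_def by (rule degree_line_poly)
    also have "\<dots> < (\<Sum>q\<in>J \<inter> l. i + h q - h p)"
      using fin p quota by (rule sum_at_quota)
    also have "\<dots> = (\<Sum>s\<in>S. i + h (p + s *\<^sub>R u) - h p)"
      unfolding image[symmetric] using inj by (simp add: sum.reindex)
    finally show "degree \<phi> < (\<Sum>s\<in>S. i + h (p + s *\<^sub>R u) - h p)" .
  qed
  moreover have "(pderiv ^^ i) (0 :: real poly) = 0" by (induction i) auto
  ultimately show ?thesis using deriv[of i 0] by simp
qed

text \<open>
The orders increase simultaneously at all points, with the head starts given by \<open>h\<close>; \<open>K\<close> is
subtracted so that no order is claimed at time \<open>N = 0\<close>. In the step, a derivative \<open>u1^i u2^j u3^k\<close> of the next order at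
\<open>p\<close> either lies in the box, or one of its exponents, say \<open>i\<close>, has reached the quota of its line.
In that case, the remaining derivative \<open>u2^j u3^k\<close> of \<open>c\<close> vanishes to the order \<open>N + h q - K - j - k = i + h q - h p\<close> at each
\<open>q\<close> by induction hypothesis, which is just what \<open>derivative_along_line_vanishes\<close> needs: the
loss of \<open>j + k\<close> orders is the same at all points of the line.
\<close>

lemma vanishes_to_order_if_box_derivatives_vanish:
  fixes u1 u2 u3 :: "real^'n::finite \<Rightarrow> real^'n"
  assumes c: "supported m c" and fin: "finite J"
    and through: "\<And>p. p \<in> J \<Longrightarrow> p \<in> l1 p \<and> p \<in> l2 p \<and> p \<in> l3 p"
    and l1: "\<And>p. p \<in> J \<Longrightarrow> has_direction (l1 p) (u1 p)"
    and l2: "\<And>p. p \<in> J \<Longrightarrow> has_direction (l2 p) (u2 p)"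
    and l3: "\<And>p. p \<in> J \<Longrightarrow> has_direction (l3 p) (u3 p)"
    and span: "\<And>p. p \<in> J \<Longrightarrow> span {u1 p, u2 p, u3 p} = UNIV"
    and box: "\<And>p i j k. p \<in> J \<Longrightarrow> i < quota (CARD('n) * m) J h p (l1 p) \<Longrightarrow>
      j < quota (CARD('n) * m) J h p (l2 p) \<Longrightarrow> k < quota (CARD('n) * m) J h p (l3 p) \<Longrightarrow>
      evaluate m ((directional (u1 p) ^^ i) ((directional (u2 p) ^^ j)
        ((directional (u3 p) ^^ k) c))) p = 0"
    and K: "\<And>p. p \<in> J \<Longrightarrow> h p \<le> K" and "p \<in> J"
  shows "vanishes_to_order m c p (N + h p - K)"
  using \<open>p \<in> J\<close>
proof (induction N arbitrary: p)
  case 0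
  then show ?case using K by (simp add: vanishes_to_order_def)
next
  case (Suc N)
  note p = \<open>p \<in> J\<close>
  have key: "evaluate m ((directional u ^^ i) ((directional v ^^ j) ((directional w ^^ k) c))) p = 0"
    if "has_direction l u" "p \<in> l" "quota (CARD('n) * m) J h p l \<le> i"
      and "i + j + k = N + h p - K" "K \<le> N + h p" for u v w l i j k
  proof (rule derivative_along_line_vanishes[OF _ fin, of _ _ p l u _ h])
    fix q assume "q \<in> J \<inter> l"
    then have "vanishes_to_order m ((directional v ^^ j) ((directional w ^^ k) c)) q
        (N + h q - K - k - j)"
      by (intro vanishes_to_order_funpow Suc.IH) simp
    moreover have "N + h q - K - k - j = i + h q - h p" using that(4,5) by linarith
    ultimately show "vanishes_to_order m ((directional v ^^ j) ((directional w ^^ k) c)) q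
        (i + h q - h p)" by simp
  qed (use that p c in \<open>auto intro: supported_funpow\<close>)
  show ?case
    unfolding vanishes_to_order_def
  proof (intro allI impI)
    fix vs :: "(real^'n) list" assume len: "length vs < Suc N + h p - K"
    show "evaluate m (fold directional vs c) p = 0"
    proof (cases "length vs < N + h p - K")
      case True
      then show ?thesis using Suc.IH[OF p] by (simp add: vanishes_to_order_def)
    next
      case False
      with len have len': "length vs = N + h p - K" "K \<le> N + h p" by auto
      show ?thesis
      proof (rule evaluate_derivatives_0_if_basis_derivatives_0[OF span[OF p] _ len'(1)])
        fix i j k assume ijk: "i + j + k = N + h p - K"
        consider "quota (CARD('n) * m) J h p (l1 p) \<le> i" | "quota (CARD('n) * m) J h p (l2 p) \<le> j"
          | "quota (CARD('n) * m) J h p (l3 p) \<le> k"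
          | "i < quota (CARD('n) * m) J h p (l1 p)" "j < quota (CARD('n) * m) J h p (l2 p)"
            "k < quota (CARD('n) * m) J h p (l3 p)" by linarith
        then show "evaluate m ((directional (u1 p) ^^ i) ((directional (u2 p) ^^ j)
            ((directional (u3 p) ^^ k) c))) p = 0"
        proof cases
          case 1
          then show ?thesis using ijk len'(2) l1[OF p] through[OF p] by (intro key[of "l1 p"]) auto
        next
          case 2
          have "evaluate m ((directional (u2 p) ^^ j) ((directional (u1 p) ^^ i)
              ((directional (u3 p) ^^ k) c))) p = 0"
            using 2 ijk len'(2) l2[OF p] through[OF p] by (intro key[of "l2 p"]) auto
          then show ?thesis by (subst funpow_directional_commute)
        next
          case 3
          have "evaluate m ((directional (u3 p) ^^ k) ((directional (u1 p) ^^ i)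
              ((directional (u2 p) ^^ j) c))) p = 0"
            using 3 ijk len'(2) l3[OF p] through[OF p] by (intro key[of "l3 p"]) auto
          then show ?thesis
            by (simp only: funpow_directional_commute[where v = "u3 p"])
        next
          case 4
          then show ?thesis by (intro box[OF p])
        qed
      qed
    qed
  qed
qed

text \<open>
With fewer conditions than coefficients, a nonzero polynomial would satisfy all box conditions. It would then
vanish to all orders at each point of \<open>J\<close>, which is impossible.
\<close>

lemma dimension_count:
  fixes u1 u2 u3 :: "real^'n::finite \<Rightarrow> real^'n" and h :: "real^'n \<Rightarrow> nat" and m :: nat
  assumes fin: "finite J" and "J \<noteq> {}"
    and through: "\<And>p. p \<in> J \<Longrightarrow> p \<in> l1 p \<and> p \<in> l2 p \<and> p \<in> l3 p"
    and l1: "\<And>p. p \<in> J \<Longrightarrow> has_direction (l1 p) (u1 p)"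
    and l2: "\<And>p. p \<in> J \<Longrightarrow> has_direction (l2 p) (u2 p)"
    and l3: "\<And>p. p \<in> J \<Longrightarrow> has_direction (l3 p) (u3 p)"
    and span: "\<And>p. p \<in> J \<Longrightarrow> span {u1 p, u2 p, u3 p} = UNIV"
  defines "Q \<equiv> quota (CARD('n) * m) J h"
  shows "Suc m ^ CARD('n) \<le> (\<Sum>p\<in>J. Q p (l1 p) * (Q p (l2 p) * Q p (l3 p)))"
proof (rule ccontr)
  assume "\<not> ?thesis"
  define E where "E = Sigma J (\<lambda>p. {..<Q p (l1 p)} \<times> {..<Q p (l2 p)} \<times> {..<Q p (l3 p)})"
  define F where "F = (\<lambda>(p, i, j, k) c. evaluate m ((directional (u1 p) ^^ i)
    ((directional (u2 p) ^^ j) ((directional (u3 p) ^^ k) c))) p)"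
  have "finite E" using fin by (auto simp: E_def)
  have "card E = (\<Sum>p\<in>J. Q p (l1 p) * (Q p (l2 p) * Q p (l3 p)))"
    using fin by (simp add: E_def card_cartesian_product)
  with \<open>\<not> ?thesis\<close> have less: "card E < card (exponents m :: ('n \<Rightarrow> nat) set)"
    by (simp add: card_exponents)
  have lin: "F e (\<lambda>u. a * f u + b * g u) = a * F e f + b * F e g" for e a b f g
    by (cases e) (simp add: F_def funpow_directional_combination evaluate_combination)
  have "\<exists>c. (\<exists>\<mu>. c \<mu> \<noteq> 0) \<and> (\<forall>\<mu>. \<mu> \<notin> exponents m \<longrightarrow> c \<mu> = 0) \<and> (\<forall>e\<in>E. F e c = 0)"
    using \<open>finite E\<close> less by (rule underdetermined_system_has_nonzero_solution) (rule lin)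
  then obtain c :: "('n \<Rightarrow> nat) \<Rightarrow> real" where c: "\<exists>\<mu>. c \<mu> \<noteq> 0" "supported m c" "\<And>e. e \<in> E \<Longrightarrow> F e c = 0"
    unfolding supported_def by blast
  define K where "K = (\<Sum>p\<in>J. h p)"
  have K: "h p \<le> K" if "p \<in> J" for p
    unfolding K_def using fin that by (intro member_le_sum) auto
  have box: "evaluate m ((directional (u1 p) ^^ i) ((directional (u2 p) ^^ j)
      ((directional (u3 p) ^^ k) c))) p = 0"
    if "p \<in> J" "i < quota (CARD('n) * m) J h p (l1 p)" "j < quota (CARD('n) * m) J h p (l2 p)"
      "k < quota (CARD('n) * m) J h p (l3 p)" for p i j k
    using c(3)[of "(p, i, j, k)"] that by (simp add: F_def E_def Q_def)
  have vanishes: "vanishes_to_order m c p (N + h p - K)" if "p \<in> J" for p N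
    using c(2) fin through l1 l2 l3 span box K that
    by (rule vanishes_to_order_if_box_derivatives_vanish)
  obtain p where p: "p \<in> J" using \<open>J \<noteq> {}\<close> by blast
  have "vanishes_to_order m c p R" for R
    using vanishes[OF p, of "R + K"] by (simp add: vanishes_to_order_def)
  then have "c = (\<lambda>_. 0)" by (rule coefficients_eq_0_if_vanishes_to_all_orders[OF c(2)])
  with c(1) show False by simp
qed

section \<open>Joints counted with multiplicity\<close>

definition spanning_triples :: "(real^3) set set \<Rightarrow> real^3 \<Rightarrow> (real^3) set set set" where
  "spanning_triples \<LL> x =
     {T. T \<subseteq> \<LL> \<and> card T = 3 \<and> (\<forall>l\<in>T. x \<in> l) \<and> directions_span T}"

lemma card_spanning_triples: "card (spanning_triples \<LL> x) = joint_multiplicity \<LL> x"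
  by (simp add: spanning_triples_def joint_multiplicity_def)

lemma span_of_line_directions:
  assumes "directions_span T" "\<And>l. l \<in> T \<Longrightarrow> has_direction l (u l)"
  shows "span (u ` T) = UNIV"
proof -
  have "v \<in> span (u ` T)" if "l \<in> T" "v \<in> line_directions l" for l v
  proof -
    from that(2) obtain p q where pq: "v = q - p" "p \<in> l" "q \<in> l"
      by (auto simp: line_directions_def)
    then obtain a where "q = p + a *\<^sub>R u l"
      using assms(2)[OF \<open>l \<in> T\<close>] unfolding has_direction_def by blast
    with pq(1) have "v = a *\<^sub>R u l" by simp
    then show ?thesis using that(1) by (simp add: span_base span_scale)
  qed
  then have "span (\<Union>l\<in>T. line_directions l) \<subseteq> span (u ` T)"
    by (intro span_minimal) auto
  then show ?thesis using assms(1) by (auto simp: directions_span_def)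
qed

lemma dimension_count_triples:
  assumes "finite S" "S \<noteq> {}" and lines: "\<And>l. l \<in> \<LL> \<Longrightarrow> is_line l"
    and \<tau>: "\<And>p. p \<in> S \<Longrightarrow> \<tau> p \<in> spanning_triples \<LL> p"
  shows "Suc m ^ 3 \<le> (\<Sum>p\<in>S. \<Prod>l\<in>\<tau> p. quota (3 * m) S h p l)"
proof -
  obtain u where u: "\<And>l. l \<in> \<LL> \<Longrightarrow> has_direction l (u l)"
    using is_line_has_direction[OF lines] by metis
  have line: "p \<in> l" "has_direction l (u l)" if "p \<in> S" "l \<in> \<tau> p" for p l
    using \<tau>[OF that(1)] that(2) u by (auto simp: spanning_triples_def)
  have "\<exists>a b c. \<tau> p = {a, b, c} \<and> a \<noteq> b \<and> a \<noteq> c \<and> b \<noteq> c" if "p \<in> S" for p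
  proof -
    have "card (\<tau> p) = 3" using \<tau>[OF that] by (simp add: spanning_triples_def)
    then show ?thesis unfolding card_3_iff by blast
  qed
  then obtain a b c where abc: "\<And>p. p \<in> S \<Longrightarrow> \<tau> p = {a p, b p, c p}"
    "\<And>p. p \<in> S \<Longrightarrow> a p \<noteq> b p \<and> a p \<noteq> c p \<and> b p \<noteq> c p" by metis
  have "span {u (a p), u (b p), u (c p)} = UNIV" if "p \<in> S" for p
  proof -
    have "span (u ` \<tau> p) = UNIV"
    proof (rule span_of_line_directions)
      show "directions_span (\<tau> p)" using \<tau>[OF that] by (simp add: spanning_triples_def)
    qed (rule line(2)[OF that])
    then show ?thesis by (simp add: abc(1)[OF that])
  qed
  then have "Suc m ^ CARD(3) \<le> (\<Sum>p\<in>S. quota (CARD(3) * m) S h p (a p) *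
      (quota (CARD(3) * m) S h p (b p) * quota (CARD(3) * m) S h p (c p)))"
    using line abc(1) by (intro dimension_count[OF assms(1,2), where ?u1.0 = "\<lambda>p. u (a p)"
        and ?u2.0 = "\<lambda>p. u (b p)" and ?u3.0 = "\<lambda>p. u (c p)"]) auto
  then have "Suc m ^ 3 \<le> (\<Sum>p\<in>S. quota (3 * m) S h p (a p) *
      (quota (3 * m) S h p (b p) * quota (3 * m) S h p (c p)))" by simp
  also have "\<dots> = (\<Sum>p\<in>S. \<Prod>l\<in>\<tau> p. quota (3 * m) S h p l)"
    using abc by (intro sum.cong) auto
  finally show ?thesis .
qed

lemma sum_Suc_quota_le:
  assumes "finite J" "finite \<LL>"
  shows "(\<Sum>p\<in>J. \<Sum>l\<in>{l\<in>\<LL>. p \<in> l}. Suc (quota n J h p l)) \<le> card \<LL> * (n + 2 * card J)"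
proof -
  have "(\<Sum>p\<in>J. \<Sum>l\<in>{l\<in>\<LL>. p \<in> l}. Suc (quota n J h p l)) =
      (\<Sum>l\<in>\<LL>. \<Sum>p\<in>{p\<in>J. p \<in> l}. Suc (quota n J h p l))"
    using assms by (intro sum.swap_restrict)
  also have "\<dots> \<le> (\<Sum>l\<in>\<LL>. n + 2 * card J)"
  proof (rule sum_mono)
    fix l
    have "(\<Sum>p\<in>J \<inter> l. Suc (quota n J h p l)) = (\<Sum>p\<in>J \<inter> l. quota n J h p l) + card (J \<inter> l)"
      by (simp add: sum_Suc)
    also have "\<dots> \<le> n + 2 * card (J \<inter> l)" using sum_quota_le[OF assms(1), of n h l] by linarith
    also have "\<dots> \<le> n + 2 * card J" using assms(1) by (simp add: card_mono)
    finally show "(\<Sum>p\<in>{p\<in>J. p \<in> l}. Suc (quota n J h p l)) \<le> n + 2 * card J"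
      by (simp add: Int_def)
  qed
  finally show ?thesis by simp
qed

text \<open>
The cube expands into a sum over all ordered triples, and each \<open>T\<close> is the set of entries of at least one of them.
\<close>

lemma sum_prod_triples_le_cube:
  fixes f :: "'b \<Rightarrow> real"
  assumes "finite A" "\<And>a. a \<in> A \<Longrightarrow> 0 \<le> f a" "\<And>T. T \<in> \<T> \<Longrightarrow> T \<subseteq> A \<and> card T = 3"
  shows "(\<Sum>T\<in>\<T>. \<Prod>a\<in>T. f a) \<le> (\<Sum>a\<in>A. f a) ^ 3"
proof -
  have "\<exists>a b c. T = {a, b, c} \<and> a \<noteq> b \<and> a \<noteq> c \<and> b \<noteq> c" if "T \<in> \<T>" for T
    using assms(3)[OF that] by (auto simp: card_3_iff)
  then obtain a b c where abc: "\<And>T. T \<in> \<T> \<Longrightarrow>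
      T = {a T, b T, c T} \<and> a T \<noteq> b T \<and> a T \<noteq> c T \<and> b T \<noteq> c T" by metis
  define g where "g T = (a T, b T, c T)" for T
  define F where "F = (\<lambda>(a, b, c). f a * (f b * f c))"
  have "inj_on g \<T>" by (rule inj_onI) (metis abc g_def prod.inject)
  have "(\<Prod>a\<in>T. f a) = F (g T)" if "T \<in> \<T>" for T
  proof -
    have "(\<Prod>a\<in>T. f a) = (\<Prod>a\<in>{a T, b T, c T}. f a)"
      by (rule arg_cong[OF conjunct1[OF abc[OF that]]])
    also have "\<dots> = F (g T)" using conjunct2[OF abc[OF that]] by (simp add: F_def g_def)
    finally show ?thesis .
  qed
  then have "(\<Sum>T\<in>\<T>. \<Prod>a\<in>T. f a) = (\<Sum>T\<in>\<T>. F (g T))" by (rule sum.cong[OF refl])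
  also have "\<dots> = (\<Sum>t\<in>g ` \<T>. F t)" using \<open>inj_on g \<T>\<close> by (simp add: sum.reindex)
  also have "\<dots> \<le> (\<Sum>t\<in>A \<times> A \<times> A. F t)"
  proof (rule sum_mono2)
    show "g ` \<T> \<subseteq> A \<times> A \<times> A" using abc assms(3) by (force simp: g_def)
  qed (use assms in \<open>auto simp: F_def\<close>)
  also have "\<dots> = (\<Sum>a\<in>A. f a) ^ 3"
    by (simp add: F_def sum.cartesian_product[symmetric] sum_product power3_eq_cube
        sum_distrib_left sum_distrib_right mult_ac)
  finally show ?thesis .
qed

text \<open>
This is the main estimate: a handicap balanced for thresholds proportional to \<open>w x\<close> makes the \<open>b p\<close>, the sums of
\<open>quota + 1\<close> over the lines through \<open>p\<close>, at least proportional to \<open>w p\<close>, while their total is at most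
\<open>5 * m\<close> times the number of lines.
\<close>

lemma sum_sqrt_multiplicity_squared_le:
  fixes \<LL> :: "(real^3) set set"
  assumes fin: "finite \<LL>" and lines: "\<And>l. l \<in> \<LL> \<Longrightarrow> is_line l"
    and J: "finite J" "\<And>x. x \<in> J \<Longrightarrow> 0 < joint_multiplicity \<LL> x"
  shows "(\<Sum>x\<in>J. sqrt (joint_multiplicity \<LL> x))\<^sup>2 \<le> 125 * real (card \<LL>) ^ 3"
proof (cases "J = {}")
  case False
  define w where "w x = sqrt (joint_multiplicity \<LL> x)" for x
  define W where "W = (\<Sum>x\<in>J. w x)"
  \<comment> \<open>The degree must be at least comparable to \<open>card J\<close>, so that the rounding errors in
    \<open>sum_Suc_quota_le\<close>, up to two for each point of \<open>J\<close> on a line, cost only a constant factor.\<close>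
  define m where "m = card J"
  have "0 < m" using J(1) False by (simp add: m_def card_gt_0_iff)
  have w: "0 < w x" if "x \<in> J" for x using J(2)[OF that] by (simp add: w_def)
  then have "0 < W" unfolding W_def using J(1) False by (intro sum_pos)
  define \<theta> where "\<theta> x = real m ^ 3 * w x / W" for x
  have "(\<Sum>x\<in>J. \<theta> x) = real m ^ 3 * W / W"
    by (simp add: \<theta>_def W_def sum_distrib_left[symmetric] sum_divide_distrib[symmetric])
  also have "\<dots> = real m ^ 3" using \<open>0 < W\<close> by simp
  also have "\<dots> < real (Suc m ^ 3)"
    unfolding of_nat_power by (rule power_strict_mono) auto
  finally have small: "(\<Sum>x\<in>J. \<theta> x) < real (Suc m ^ 3)" .
  have "\<exists>h. \<forall>p\<in>J. \<forall>T\<in>spanning_triples \<LL> p. \<theta> p < (\<Prod>l\<in>T. real (Suc (quota (3 * m) J h p l)))"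
  proof (rule exists_balanced_handicap[OF J(1) _ _ _ small])
    fix S h \<tau> assume "S \<subseteq> J" "S \<noteq> {}" "\<And>p. p \<in> S \<Longrightarrow> \<tau> p \<in> spanning_triples \<LL> p"
    then have "Suc m ^ 3 \<le> (\<Sum>p\<in>S. \<Prod>l\<in>\<tau> p. quota (3 * m) S h p l)"
      using J(1) lines by (intro dimension_count_triples[of S \<LL>]) (auto intro: finite_subset)
    then have "real (Suc m ^ 3) \<le> real (\<Sum>p\<in>S. \<Prod>l\<in>\<tau> p. quota (3 * m) S h p l)"
      by (simp only: of_nat_le_iff)
    then show "real (Suc m ^ 3) \<le> (\<Sum>p\<in>S. \<Prod>l\<in>\<tau> p. real (quota (3 * m) S h p l))"
      by simp
  qed (use w \<open>0 < W\<close> in \<open>auto simp: spanning_triples_def \<theta>_def less_imp_le\<close>)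
  then obtain h where h: "\<And>p T. p \<in> J \<Longrightarrow> T \<in> spanning_triples \<LL> p \<Longrightarrow>
      \<theta> p < (\<Prod>l\<in>T. real (Suc (quota (3 * m) J h p l)))" by blast
  define b where "b p = (\<Sum>l\<in>{l\<in>\<LL>. p \<in> l}. real (Suc (quota (3 * m) J h p l)))" for p
  define k where "k = root 3 W"
  have k: "k ^ 3 = W" "0 < k" using \<open>0 < W\<close> by (auto simp: k_def)
  have "m * w p / k \<le> b p" if p: "p \<in> J" for p
  proof (rule power_le_imp_le_base)
    \<comment> \<open>Here the exponent \<open>1/2\<close> enters: only for \<open>w p = N p ^ (1/2)\<close> is \<open>N p * w p\<close> the cube of \<open>w p\<close>.\<close>
    have "real (joint_multiplicity \<LL> p) = w p ^ 2" by (simp add: w_def)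
    then have "(m * w p / k) ^ Suc 2 = real (joint_multiplicity \<LL> p) * \<theta> p"
      using k by (simp add: \<theta>_def power_divide power_mult_distrib power2_eq_square power3_eq_cube)
    also have "\<dots> = (\<Sum>T\<in>spanning_triples \<LL> p. \<theta> p)" by (simp add: card_spanning_triples)
    also have "\<dots> \<le> (\<Sum>T\<in>spanning_triples \<LL> p. \<Prod>l\<in>T. real (Suc (quota (3 * m) J h p l)))"
      by (intro sum_mono less_imp_le h p)
    also have "\<dots> \<le> b p ^ 3"
      unfolding b_def using fin by (intro sum_prod_triples_le_cube) (auto simp: spanning_triples_def)
    finally show "(m * w p / k) ^ Suc 2 \<le> b p ^ Suc 2" by simp
    show "0 \<le> b p" unfolding b_def by (intro sum_nonneg) auto
  qed
  then have "(\<Sum>p\<in>J. m * w p / k) \<le> (\<Sum>p\<in>J. b p)" by (rule sum_mono)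
  also have "\<dots> = real (\<Sum>p\<in>J. \<Sum>l\<in>{l\<in>\<LL>. p \<in> l}. Suc (quota (3 * m) J h p l))"
    by (simp add: b_def)
  also have "\<dots> \<le> real (card \<LL> * (3 * m + 2 * card J))"
    using sum_Suc_quota_le[OF J(1) fin] by (simp only: of_nat_le_iff)
  also have "\<dots> = real m * (5 * card \<LL>)" by (simp add: m_def)
  finally have "real m * (W / k) \<le> real m * (5 * card \<LL>)"
    by (simp add: W_def sum_distrib_left sum_divide_distrib)
  then have "W / k \<le> 5 * card \<LL>" by (rule mult_left_le_imp_le) (use \<open>0 < m\<close> in simp)
  then have "(W / k) ^ 3 \<le> (5 * real (card \<LL>)) ^ 3"
    using \<open>0 < W\<close> k(2) by (intro power_mono) auto
  then have "W ^ 3 \<le> W * (125 * real (card \<LL>) ^ 3)"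
    using \<open>0 < W\<close> k by (simp add: power_divide power_mult_distrib divide_le_eq mult_ac)
  then have "W * W\<^sup>2 \<le> W * (125 * real (card \<LL>) ^ 3)" by (simp add: power3_eq_cube power2_eq_square)
  then show ?thesis using \<open>0 < W\<close> by (simp add: W_def w_def)
qed simp

theorem theorem1p1:
  shows "\<exists>c::real. \<forall>\<LL>::(real^3) set set.
    finite \<LL> \<and> (\<forall>l\<in>\<LL>. is_line l) \<longrightarrow>
    (\<Sum>x\<in>joints \<LL>. real (joint_multiplicity \<LL> x) powr (1/2))
      \<le> c * real (card \<LL>) powr (3/2)"
proof (intro exI[of _ "sqrt 125"] allI impI)
  fix \<LL> :: "(real^3) set set"
  assume \<LL>: "finite \<LL> \<and> (\<forall>l\<in>\<LL>. is_line l)"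
  \<comment> \<open>The estimate above is for points of positive multiplicity; the terms of other points are zero.\<close>
  define J where "J = {x \<in> joints \<LL>. 0 < joint_multiplicity \<LL> x}"
  have fin: "finite (joints \<LL>)" using \<LL> by (intro finite_joints) auto
  have "(\<Sum>x\<in>joints \<LL>. real (joint_multiplicity \<LL> x) powr (1/2)) =
      (\<Sum>x\<in>J. sqrt (joint_multiplicity \<LL> x))"
    using fin by (intro sum.mono_neutral_cong_right) (auto simp: J_def powr_half_sqrt)
  also have "\<dots> \<le> sqrt (125 * real (card \<LL>) ^ 3)"
    using \<LL> fin by (intro real_le_rsqrt sum_sqrt_multiplicity_squared_le) (auto simp: J_def)
  also have "\<dots> = sqrt 125 * real (card \<LL>) powr (3/2)"
  proof (cases "card \<LL> = 0")
    case False
    then have "sqrt (real (card \<LL>) ^ 3) = (real (card \<LL>) powr 3) powr (1/2)"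
      by (simp add: powr_half_sqrt)
    also have "\<dots> = real (card \<LL>) powr (3/2)" by (simp only: powr_powr) simp
    finally show ?thesis by (simp add: real_sqrt_mult)
  qed simp
  finally show "(\<Sum>x\<in>joints \<LL>. real (joint_multiplicity \<LL> x) powr (1/2))
      \<le> sqrt 125 * real (card \<LL>) powr (3/2)" .
qed

end
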